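(* Let $\mathfrak n$ be a nonzero ideal of $A$ and $\mathfrak p$ a prime ideal of $A$ with $\mathfrak p^\alpha\,\|\,\mathfrak n$ for some integer $\alpha\ge 1$. Let $k\ge1$ and $0\le l\le q-2$ be integers with $k\equiv 2l\pmod{q-1}$. For all prime divisors $\mathfrak p_1$ of $\mathfrak n$ with $\mathfrak p_1\ne\mathfrak p$, the actions of $U_{\mathfrak p_1}W_{\mathfrak p^\alpha}^{(\mathfrak n)}$ and $W_{\mathfrak p^\alpha}^{(\mathfrak n)}U_{\mathfrak p_1}$ on $S_{k,l}(\Gamma_0(\mathfrak n))$ are equal.
   Context: Let $q$ be a power of an odd prime, $A=\mathbb{F}_q[T]$, $K_\infty=\mathbb{F}_q((1/T))$, $C$ the completion of an algebraic closure of $K_\infty$, and $\Omega=C\setminus K_\infty$ the Drinfeld upper half-plane with its rigid analytic structure. For $\gamma=\begin{pmatrix} a & b \\ c & d \end{pmatrix}\in\mathrm{GL}_2(K_\infty)$ and $f:\Omega\to C$ rigid holomorphic put $(f|_{k,l}\gamma)(z)=(\det\gamma)^l(cz+d)^{-k}f(\gamma z)$. For a nonzero ideal $\mathfrak n=(n)$ of $A$ ($n$ monic), $\Gamma_0(\mathfrak n)=\{\begin{pmatrix} a & b \\ c & d \end{pmatrix}\in\mathrm{GL}_2(A): c\in\mathfrak n\}$. Let $\tilde\pi$ be the Carlitz period (so $L=\tilde\pi A$ is the lattice of the Carlitz module $\rho_T=TX+X^q$), $e_L(z)=z\prod_{0\ne\lambda\in L}(1-z/\lambda)$, $u(z)=1/e_L(\tilde\pi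 z)$. $S_{k,l}(\Gamma_0(\mathfrak n))$ is the $C$-space of Drinfeld cusp forms of weight $k$, type $l$: rigid holomorphic $f:\Omega\to C$ with $f|_{k,l}\gamma=f$ for all $\gamma\in\Gamma_0(\mathfrak n)$ which are holomorphic and vanish at the cusps, i.e. for every $\gamma\in\mathrm{GL}_2(A)$ the expansion of $f|_{k,l}\gamma$ in powers of $u(z/n)$ (for $\inf_{x\in K_\infty}|z-x|$ large) has only positive powers. $\mathfrak p^\alpha\|\mathfrak n$ means $\mathfrak p^\alpha\mid\mathfrak n$ and $(\mathfrak p^\alpha,\mathfrak n/\mathfrak p^\alpha)=1$. With $\mathfrak p=(P)$, $P$ monic irreducible, the (partial) Atkin–Lehner operator is $f|W_{\mathfrak p^\alpha}^{(\mathfrak n)}=f|_{k,l}\begin{pmatrix} P^\alpha & b \\ n & P^\alpha d \end{pmatrix}$ where $b,d\in A$ satisfy $P^{2\alpha}d-nb=P^\alpha$ (independent of the choice). For a prime $\mathfrak p_1=(P_1)\mid\mathfrak n$ ($P_1$ monic), $U_{\mathfrak p_1}(f)=P_1^{k-l}\sum_{Q\in A,\ \deg Q<\deg P_1}f|_{k,l}\begin{pmatrix} 1 & Q \\ 0 & P_1 \end{pmatrix}$. The claim says $U_{\mathfrak p_1}(f|W_{\mathfrak p^\alpha}^{(\mathfrak n)})=(U_{\mathfrak p_1}f)|W_{\mathfrak p^\alpha}^{(\mathfrak n)}$ for all $f\in S_{k,l}(\Gamma_0(\mathfrak n))$. *)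

theory Defs
  imports
    "HOL-Analysis.Analysis"
    "HOL-Computational_Algebra.Computational_Algebra"
    "HOL-Number_Theory.Cong"
begin

text \<open>
  The finite field is a type \<open>'a\<close> with \<open>q = CARD('a)\<close> elements, \<open>A = 'a poly\<close>, and
  the field of Laurent series in \<open>1/T\<close> is \<open>'a fls\<close>, whose variable \<open>fls_X\<close> stands for
  \<open>1/T\<close>. The field \<open>C\<close> is a type \<open>'c\<close> carrying a field structure and a complete metric,
  together with an embedding \<open>\<iota> :: 'a fls \<Rightarrow> 'c\<close>.
\<close>

unbundle no Formal_Power_Series.fps_syntax

section \<open>The fields\<close>

definition Kinf_of_poly :: "'a::field poly \<Rightarrow> 'a fls" where
  "Kinf_of_poly p = poly (map_poly fls_const p) fls_X_inv"

definition absval_Kinf :: "'a::{finite,field} fls \<Rightarrow> real" where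
  "absval_Kinf x = (if x = 0 then 0 else real CARD('a) powi (- fls_subdegree x))"

definition algebraic_elements :: "('a::field fls \<Rightarrow> 'c::field) \<Rightarrow> 'c set" where
  "algebraic_elements \<iota> =
     {x. \<exists>p. p \<noteq> 0 \<and> (\<forall>i. coeff p i \<in> range \<iota>) \<and> poly p x = 0}"

text \<open>
  The following says that \<open>'c\<close>, with the absolute value \<open>|x| = dist x 0\<close>, is the completion of
  an algebraic closure of \<open>'a fls\<close>: completeness is part of the type class, the elements
  algebraic over the image of \<open>\<iota>\<close> form an algebraically closed field, and they are dense.
  This determines \<open>'c\<close> up to isometric isomorphism over \<open>'a fls\<close>.
\<close>

locale completed_algebraic_closure =
  fixes \<iota> :: "'a::{finite,field} fls \<Rightarrow> 'c::{field,complete_space}"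
  assumes hom_one: "\<iota> 1 = 1"
    and hom_add: "\<And>x y. \<iota> (x + y) = \<iota> x + \<iota> y"
    and hom_mult: "\<And>x y. \<iota> (x * y) = \<iota> x * \<iota> y"
    and dist_translate: "\<And>x y z :: 'c. dist (x + z) (y + z) = dist x y"
    and absval_mult: "\<And>x y :: 'c. dist (x * y) 0 = dist x 0 * dist y 0"
    and absval_ultrametric: "\<And>x y :: 'c. dist (x + y) 0 \<le> max (dist x 0) (dist y 0)"
    and absval_extends: "\<And>x. dist (\<iota> x) 0 = absval_Kinf x"
    and algebraically_closed:
      "\<And>p :: 'c poly. \<lbrakk>\<forall>i. coeff p i \<in> algebraic_elements \<iota>; degree p > 0\<rbrakk>
         \<Longrightarrow> \<exists>x \<in> algebraic_elements \<iota>. poly p x = 0"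
    and algebraic_dense: "closure (algebraic_elements \<iota>) = UNIV"

definition C_of_poly :: "('a::field fls \<Rightarrow> 'c) \<Rightarrow> 'a poly \<Rightarrow> 'c" where
  "C_of_poly \<iota> p = \<iota> (Kinf_of_poly p)"


section \<open>The Drinfeld upper half-plane\<close>

definition Omega :: "('a fls \<Rightarrow> 'c) \<Rightarrow> 'c::field set" where
  "Omega \<iota> = UNIV - range \<iota>"

definition imag_absval :: "('a::zero fls \<Rightarrow> 'c::metric_space) \<Rightarrow> 'c \<Rightarrow> real" where
  "imag_absval \<iota> z = (INF x. dist z (\<iota> x))"

text \<open>
  The sets \<open>Omega_affinoid \<iota> m\<close> are the connected affinoids of the standard admissible covering
  of \<open>\<Omega>\<close>. A function on \<open>\<Omega>\<close> is rigid holomorphic iff on each of them it is a uniform limit of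
  rational functions without poles there.
\<close>

definition Omega_affinoid ::
    "('a::{finite,field} fls \<Rightarrow> 'c::{field,metric_space}) \<Rightarrow> nat \<Rightarrow> 'c set" where
  "Omega_affinoid \<iota> m =
     {z. dist z 0 \<le> real CARD('a) ^ m \<and> imag_absval \<iota> z \<ge> 1 / real CARD('a) ^ m}"

definition rigid_holomorphic ::
    "('a::{finite,field} fls \<Rightarrow> 'c::{field,metric_space}) \<Rightarrow> ('c \<Rightarrow> 'c) \<Rightarrow> bool" where
  "rigid_holomorphic \<iota> f \<longleftrightarrow>
     (\<forall>m. \<forall>\<epsilon>>0. \<exists>p r :: 'c poly. \<forall>z \<in> Omega_affinoid \<iota> m.
        poly r z \<noteq> 0 \<and> dist (f z) (poly p z / poly r z) < \<epsilon>)"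


section \<open>Slash operators\<close>

definition mat22 :: "'r \<Rightarrow> 'r \<Rightarrow> 'r \<Rightarrow> 'r \<Rightarrow> 'r::zero^2^2" where
  "mat22 a b c d = vector [vector [a, b], vector [c, d]]"

definition frac_lin :: "('a fls \<Rightarrow> 'c::field) \<Rightarrow> 'a::field fls^2^2 \<Rightarrow> 'c \<Rightarrow> 'c" where
  "frac_lin \<iota> \<gamma> z = (\<iota> (\<gamma>$1$1) * z + \<iota> (\<gamma>$1$2)) / (\<iota> (\<gamma>$2$1) * z + \<iota> (\<gamma>$2$2))"

definition slash ::
    "('a fls \<Rightarrow> 'c::field) \<Rightarrow> nat \<Rightarrow> nat \<Rightarrow> ('c \<Rightarrow> 'c) \<Rightarrow> 'a::field fls^2^2 \<Rightarrow> 'c \<Rightarrow> 'c" where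
  "slash \<iota> k l f \<gamma> z =
     \<iota> (det \<gamma>) ^ l * inverse ((\<iota> (\<gamma>$2$1) * z + \<iota> (\<gamma>$2$2)) ^ k) * f (frac_lin \<iota> \<gamma> z)"

abbreviation slash_A ::
    "('a fls \<Rightarrow> 'c::field) \<Rightarrow> nat \<Rightarrow> nat \<Rightarrow> ('c \<Rightarrow> 'c) \<Rightarrow> 'a::field poly^2^2 \<Rightarrow> 'c \<Rightarrow> 'c" where
  "slash_A \<iota> k l f \<gamma> \<equiv> slash \<iota> k l f (map_matrix Kinf_of_poly \<gamma>)"

definition GL2_A :: "('a::field poly^2^2) set" where
  "GL2_A = {\<gamma>. invertible \<gamma>}"

definition Gamma0 :: "'a::field poly \<Rightarrow> ('a poly^2^2) set" where
  "Gamma0 n = {\<gamma> \<in> GL2_A. n dvd \<gamma>$2$1}"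


section \<open>The parameter at infinity\<close>

definition lattice_exp :: "'c set \<Rightarrow> 'c \<Rightarrow> 'c::{field,t2_space}" where
  "lattice_exp L z =
     z * Lim (finite_subsets_at_top (L - {0})) (\<lambda>F. \<Prod>x\<in>F. 1 - z / x)"

definition A_multiples :: "('a::field fls \<Rightarrow> 'c::field) \<Rightarrow> 'c \<Rightarrow> 'c set" where
  "A_multiples \<iota> \<omega> = range (\<lambda>a. \<omega> * C_of_poly \<iota> a)"

text \<open>
  \<open>\<omega>\<close> is a Carlitz period if \<open>e\<^sub>L(Tz) = T e\<^sub>L(z) + e\<^sub>L(z)\<^sup>q\<close> for \<open>L = \<omega>A\<close>, that is, if \<open>L\<close> is the
  lattice of the Carlitz module. This fixes \<open>\<omega>\<close> up to a nonzero constant of the finite field.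
  Below, \<open>[:0, 1:]\<close> is \<open>T\<close>.
\<close>

definition carlitz_period ::
    "('a::{finite,field} fls \<Rightarrow> 'c::{field,t2_space}) \<Rightarrow> 'c \<Rightarrow> bool" where
  "carlitz_period \<iota> \<omega> \<longleftrightarrow> \<omega> \<noteq> 0 \<and>
     (let e = lattice_exp (A_multiples \<iota> \<omega>); T = C_of_poly \<iota> [:0, 1:]
      in \<forall>z. e (T * z) = T * e z + e z ^ CARD('a))"

definition u_param :: "('a::field fls \<Rightarrow> 'c::{field,t2_space}) \<Rightarrow> 'c \<Rightarrow> 'c \<Rightarrow> 'c" where
  "u_param \<iota> \<omega> z = 1 / lattice_exp (A_multiples \<iota> \<omega>) (\<omega> * z)"


section \<open>Drinfeld cusp forms\<close>

text \<open>
  Functions on \<open>\<Omega>\<close> are represented by functions on \<open>'c\<close>; values outside \<open>Omega \<iota>\<close> are irrelevant.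
\<close>

definition vanishes_at_infinity ::
    "('a::field fls \<Rightarrow> 'c::{field,metric_space}) \<Rightarrow> 'c \<Rightarrow> 'a poly \<Rightarrow> ('c \<Rightarrow> 'c) \<Rightarrow> bool" where
  "vanishes_at_infinity \<iota> \<omega> n g \<longleftrightarrow>
     (\<exists>(a :: nat \<Rightarrow> 'c) (R :: real). \<forall>z \<in> Omega \<iota>. imag_absval \<iota> z \<ge> R \<longrightarrow>
        (\<lambda>j. a (Suc j) * u_param \<iota> \<omega> (z / C_of_poly \<iota> n) ^ Suc j) sums g z)"

definition cusp_forms ::
    "('a::{finite,field} fls \<Rightarrow> 'c::{field,metric_space}) \<Rightarrow> 'c \<Rightarrow> nat \<Rightarrow> nat \<Rightarrow> 'a poly
      \<Rightarrow> ('c \<Rightarrow> 'c) set" where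
  "cusp_forms \<iota> \<omega> k l n =
     {f. rigid_holomorphic \<iota> f \<and>
         (\<forall>\<gamma> \<in> Gamma0 n. \<forall>z \<in> Omega \<iota>. slash_A \<iota> k l f \<gamma> z = f z) \<and>
         (\<forall>\<gamma> \<in> GL2_A. vanishes_at_infinity \<iota> \<omega> n (slash_A \<iota> k l f \<gamma>))}"


section \<open>Atkin--Lehner and U operators\<close>

definition atkin_lehner_matrix ::
    "'a::field poly \<Rightarrow> 'a poly \<Rightarrow> nat \<Rightarrow> 'a poly^2^2 \<Rightarrow> bool" where
  "atkin_lehner_matrix n P \<alpha> M \<longleftrightarrow>
     (\<exists>b d. P ^ (2 * \<alpha>) * d - n * b = P ^ \<alpha> \<and> M = mat22 (P ^ \<alpha>) b n (P ^ \<alpha> * d))"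

definition atkin_lehner ::
    "('a fls \<Rightarrow> 'c::field) \<Rightarrow> nat \<Rightarrow> nat \<Rightarrow> 'a::field poly \<Rightarrow> 'a poly \<Rightarrow> nat
      \<Rightarrow> ('c \<Rightarrow> 'c) \<Rightarrow> 'c \<Rightarrow> 'c" where
  "atkin_lehner \<iota> k l n P \<alpha> f = slash_A \<iota> k l f (SOME M. atkin_lehner_matrix n P \<alpha> M)"

definition U_operator ::
    "('a fls \<Rightarrow> 'c::field) \<Rightarrow> nat \<Rightarrow> nat \<Rightarrow> 'a::field poly \<Rightarrow> ('c \<Rightarrow> 'c) \<Rightarrow> 'c \<Rightarrow> 'c" where
  "U_operator \<iota> k l P f z =
     C_of_poly \<iota> P powi (int k - int l) *
     (\<Sum>Q | degree Q < degree P. slash_A \<iota> k l f (mat22 1 Q 0 P) z)"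


section \<open>The Atkin--Lehner operator does not depend on the choice of matrix\<close>

lemma Kinf_of_poly_simps [simp]:
  fixes p r :: "'a::field poly"
  shows "Kinf_of_poly 0 = 0" "Kinf_of_poly 1 = 1"
    "Kinf_of_poly (p + r) = Kinf_of_poly p + Kinf_of_poly r"
    "Kinf_of_poly (p * r) = Kinf_of_poly p * Kinf_of_poly r"
proof -
  show "Kinf_of_poly 0 = 0" "Kinf_of_poly 1 = 1"
    by (simp_all add: Kinf_of_poly_def)
  show add: "Kinf_of_poly (p + r) = Kinf_of_poly p + Kinf_of_poly r" for p r :: "'a poly"
  proof -
    have "map_poly fls_const (p + r) = map_poly fls_const p + map_poly fls_const r"
      by (rule poly_eqI) (simp add: coeff_map_poly fls_plus_const)
    then show ?thesis by (simp add: Kinf_of_poly_def)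
  qed
  have smult: "Kinf_of_poly (smult c p) = fls_const c * Kinf_of_poly p" for c :: 'a and p
    by (simp add: Kinf_of_poly_def map_poly_smult)
  have shift: "Kinf_of_poly (pCons 0 p) = fls_X_inv * Kinf_of_poly p" for p :: "'a poly"
    by (simp add: Kinf_of_poly_def map_poly_pCons)
  show "Kinf_of_poly (p * r) = Kinf_of_poly p * Kinf_of_poly r" for p r :: "'a poly"
  proof (induction p)
    case 0
    show ?case by (simp add: Kinf_of_poly_def)
  next
    case (pCons a p)
    have *: "Kinf_of_poly (pCons a p) = fls_const a + fls_X_inv * Kinf_of_poly p"
      by (simp add: Kinf_of_poly_def map_poly_pCons)
    show ?case
      by (simp add: add smult shift pCons.IH * algebra_simps)
  qed
qed

lemma Kinf_of_poly_diff [simp]: "Kinf_of_poly (p - r) = Kinf_of_poly p - Kinf_of_poly r"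
  by (metis Kinf_of_poly_simps(3) add_diff_cancel_right' diff_add_cancel)

lemma Kinf_of_poly_nth: "fls_nth (Kinf_of_poly p) i = (if i \<le> 0 then coeff p (nat (- i)) else 0)"
proof (induction p arbitrary: i)
  case 0
  show ?case by simp
next
  case (pCons a p)
  have "Kinf_of_poly (pCons a p) = fls_const a + fls_X_inv * Kinf_of_poly p"
    by (simp add: Kinf_of_poly_def map_poly_pCons)
  then have "fls_nth (Kinf_of_poly (pCons a p)) i =
      (if i = 0 then a else 0) + fls_nth (Kinf_of_poly p) (i + 1)"
    by (simp add: fls_X_inv_times_conv_shift)
  moreover have "nat (- i) = Suc (nat (- (i + 1)))" if "i < 0"
    using that by simp
  ultimately show ?case
    by (auto simp: pCons.IH)
qed

lemma Kinf_of_poly_eq_0_iff [simp]: "Kinf_of_poly p = 0 \<longleftrightarrow> p = 0"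
proof
  assume "Kinf_of_poly p = 0"
  then have "coeff p i = 0" for i
    using Kinf_of_poly_nth[of p "- int i"] by simp
  then show "p = 0" by (simp add: poly_eq_iff)
qed simp

lemma mat22_nth [simp]:
  "mat22 a b c d $ 1 $ 1 = a" "mat22 a b c d $ 1 $ 2 = b"
  "mat22 a b c d $ 2 $ 1 = c" "mat22 a b c d $ 2 $ 2 = d"
  by (simp_all add: mat22_def)

lemma mat22_mult_nth:
  fixes \<gamma> \<delta> :: "'r::semiring_1^2^2"
  shows "(\<gamma> ** \<delta>) $ i $ j = \<gamma>$i$1 * \<delta>$1$j + \<gamma>$i$2 * \<delta>$2$j"
  by (simp add: matrix_matrix_mult_def sum_2)

lemma map_matrix_Kinf_mult:
  fixes \<gamma> \<delta> :: "'a::field poly^2^2"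
  shows "map_matrix Kinf_of_poly (\<gamma> ** \<delta>) =
     map_matrix Kinf_of_poly \<gamma> ** map_matrix Kinf_of_poly \<delta>"
  by (simp add: vec_eq_iff mat22_mult_nth)

context completed_algebraic_closure
begin

lemma embedding_zero [simp]: "\<iota> 0 = 0"
  by (metis add_cancel_right_right hom_add)

lemma embedding_diff: "\<iota> (x - y) = \<iota> x - \<iota> y"
  by (metis add_diff_cancel_right' diff_add_cancel hom_add)

lemma embedding_eq_0_iff [simp]: "\<iota> x = 0 \<longleftrightarrow> x = 0"
  by (metis embedding_zero hom_mult hom_one mult_zero_left right_inverse zero_neq_one)

lemma embedding_inverse: "\<iota> (inverse x) = inverse (\<iota> x)"
  by (metis embedding_zero hom_mult hom_one inverse_unique inverse_zero right_inverse)

lemma Omega_denominator_nonzero: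
  assumes "z \<in> Omega \<iota>" and "c \<noteq> 0 \<or> d \<noteq> 0"
  shows "\<iota> c * z + \<iota> d \<noteq> 0"
proof
  assume *: "\<iota> c * z + \<iota> d = 0"
  show False
  proof (cases "c = 0")
    case True
    then show False using * assms by simp
  next
    case False
    then have "z = \<iota> ((0 - d) * inverse c)"
      using * by (simp only: hom_mult embedding_inverse embedding_diff embedding_zero)
        (simp add: field_simps eq_neg_iff_add_eq_0)
    then show False using assms by (auto simp: Omega_def)
  qed
qed

lemma frac_lin_in_Omega:
  assumes z: "z \<in> Omega \<iota>" and det: "det \<gamma> \<noteq> 0"
  shows "frac_lin \<iota> \<gamma> z \<in> Omega \<iota>"
proof (rule ccontr)
  let ?a = "\<gamma>$1$1" and ?b = "\<gamma>$1$2" and ?c = "\<gamma>$2$1" and ?d = "\<gamma>$2$2"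
  assume "frac_lin \<iota> \<gamma> z \<notin> Omega \<iota>"
  then obtain x where x: "frac_lin \<iota> \<gamma> z = \<iota> x"
    by (auto simp: Omega_def)
  have nz: "\<iota> ?c * z + \<iota> ?d \<noteq> 0"
    by (rule Omega_denominator_nonzero[OF z]) (use det in \<open>auto simp: det_2\<close>)
  have "\<iota> ?a * z + \<iota> ?b = \<iota> x * (\<iota> ?c * z + \<iota> ?d)"
    using x nz by (simp add: frac_lin_def field_simps)
  then have "\<iota> (?a - x * ?c) * z + \<iota> (?b - x * ?d) = 0"
    by (simp add: hom_mult embedding_diff algebra_simps)
  then have "?a - x * ?c = 0 \<and> ?b - x * ?d = 0"
    using Omega_denominator_nonzero[OF z] by blast
  then have "det \<gamma> = 0" by (simp add: det_2)
  then show False using det by simp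
qed

lemma slash_mult:
  assumes z: "z \<in> Omega \<iota>" and det: "det \<gamma> \<noteq> 0" "det \<delta> \<noteq> 0"
  shows "slash \<iota> k l f (\<gamma> ** \<delta>) z = slash \<iota> k l (slash \<iota> k l f \<gamma>) \<delta> z"
proof -
  let ?w = "frac_lin \<iota> \<delta> z"
  define j where "j = \<iota> (\<delta>$2$1) * z + \<iota> (\<delta>$2$2)"
  define j' where "j' = \<iota> (\<gamma>$2$1) * ?w + \<iota> (\<gamma>$2$2)"
  have j: "j \<noteq> 0"
    unfolding j_def
    by (rule Omega_denominator_nonzero[OF z]) (use det in \<open>auto simp: det_2\<close>)
  have w: "?w * j = \<iota> (\<delta>$1$1) * z + \<iota> (\<delta>$1$2)"
    using j by (simp add: frac_lin_def j_def)
  have den: "\<iota> ((\<gamma> ** \<delta>)$2$1) * z + \<iota> ((\<gamma> ** \<delta>)$2$2) = j' * j"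
  proof -
    have "j' * j = \<iota> (\<gamma>$2$1) * (?w * j) + \<iota> (\<gamma>$2$2) * j"
      by (simp add: j'_def algebra_simps)
    then show ?thesis unfolding w
      by (simp add: j_def mat22_mult_nth hom_add hom_mult algebra_simps)
  qed
  have num: "\<iota> ((\<gamma> ** \<delta>)$1$1) * z + \<iota> ((\<gamma> ** \<delta>)$1$2) =
      (\<iota> (\<gamma>$1$1) * ?w + \<iota> (\<gamma>$1$2)) * j"
  proof -
    have "(\<iota> (\<gamma>$1$1) * ?w + \<iota> (\<gamma>$1$2)) * j = \<iota> (\<gamma>$1$1) * (?w * j) + \<iota> (\<gamma>$1$2) * j"
      by (simp add: algebra_simps)
    then show ?thesis unfolding w
      by (simp add: j_def mat22_mult_nth hom_add hom_mult algebra_simps)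
  qed
  have "frac_lin \<iota> (\<gamma> ** \<delta>) z = frac_lin \<iota> \<gamma> ?w"
    using j unfolding frac_lin_def[of _ "\<gamma> ** \<delta>"] den num
    by (simp add: frac_lin_def[of _ \<gamma>] j'_def)
  then show ?thesis
    unfolding slash_def den det_mul hom_mult power_mult_distrib inverse_mult_distrib
    unfolding j_def[symmetric] j'_def[symmetric] by (simp only: mult_ac)
qed

end

lemma poly_bezout:
  fixes a b :: "'a::field poly"
  shows "\<exists>x y. (x * a + y * b) dvd a \<and> (x * a + y * b) dvd b"
proof (induction "euclidean_size b" arbitrary: a b rule: less_induct)
  case less
  show ?case
  proof (cases "b = 0")
    case True
    then show ?thesis by (intro exI[of _ 1] exI[of _ 0]) simp
  next
    case False
    then have "euclidean_size (a mod b) < euclidean_size b"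
      by (rule mod_size_less)
    from less[OF this] obtain x y
      where d: "x * b + y * (a mod b) dvd b" "x * b + y * (a mod b) dvd a mod b" by blast
    have "x * b + y * (a mod b) = y * a + (x - y * (a div b)) * b"
      by (simp add: minus_div_mult_eq_mod[symmetric] algebra_simps)
    then show ?thesis
      using d by (metis dvd_mod_iff)
  qed
qed

lemma atkin_lehner_matrix_exists:
  fixes n P :: "'a::field poly"
  assumes "P ^ \<alpha> dvd n" "coprime (P ^ \<alpha>) (n div P ^ \<alpha>)"
  shows "\<exists>M. atkin_lehner_matrix n P \<alpha> M"
proof -
  obtain x y where "is_unit (x * P ^ \<alpha> + y * (n div P ^ \<alpha>))"
    using poly_bezout[of "P ^ \<alpha>" "n div P ^ \<alpha>"] assms(2) by (meson coprime_def)
  then obtain v where "1 = (x * P ^ \<alpha> + y * (n div P ^ \<alpha>)) * v" by (rule dvdE)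
  then have "P ^ \<alpha> = (x * P ^ \<alpha> + y * (n div P ^ \<alpha>)) * v * P ^ \<alpha>" by simp
  also have "\<dots> = P ^ \<alpha> * P ^ \<alpha> * (x * v) + (P ^ \<alpha> * (n div P ^ \<alpha>)) * (y * v)"
    by (simp add: algebra_simps)
  also have "\<dots> = P ^ (2 * \<alpha>) * (x * v) - n * (- (y * v))"
    using assms(1) by (simp add: mult_2 power_add)
  finally show ?thesis
    unfolding atkin_lehner_matrix_def by metis
qed

lemma atkin_lehner_matrix_unique:
  fixes n P :: "'a::field poly"
  assumes P: "P \<noteq> 0" "P ^ \<alpha> dvd n"
    and M: "atkin_lehner_matrix n P \<alpha> M" and M': "atkin_lehner_matrix n P \<alpha> M'"
  shows "\<exists>\<gamma> \<in> Gamma0 n. M' = \<gamma> ** M"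
proof -
  define p where "p = P ^ \<alpha>"
  obtain m where m: "n = p * m" using P by (auto simp: p_def)
  have p: "p \<noteq> 0" using P by (simp add: p_def)
  have P2: "P ^ (2 * \<alpha>) = p * p" by (simp add: p_def mult_2 power_add)
  obtain b d where "p * p * d - n * b = p" and M_eq: "M = mat22 p b n (p * d)"
    using M unfolding atkin_lehner_matrix_def P2 p_def[symmetric] by blast
  then have "p * (p * d - m * b) = p * 1"
    by (simp add: m algebra_simps)
  then have bd: "p * d - m * b = 1" using p by (simp only: mult_cancel_left) simp
  obtain b' d' where "p * p * d' - n * b' = p" and M'_eq: "M' = mat22 p b' n (p * d')"
    using M' unfolding atkin_lehner_matrix_def P2 p_def[symmetric] by blast
  then have "p * (p * d' - m * b') = p * 1"
    by (simp add: m algebra_simps)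
  then have bd': "p * d' - m * b' = 1" using p by (simp only: mult_cancel_left) simp
  define \<gamma> where "\<gamma> = mat22 (p * d - m * b') (b' - b) (n * (d - d')) (p * d' - m * b)"
  define \<gamma>' where "\<gamma>' = mat22 (p * d' - m * b) (b - b') (n * (d' - d)) (p * d - m * b')"
  have d: "p * d = 1 + m * b" "p * d' = 1 + m * b'"
    using bd bd' by (simp_all add: algebra_simps)
  have "\<gamma> ** \<gamma>' = mat 1 \<and> \<gamma>' ** \<gamma> = mat 1"
  proof -
    have e: "n * (d - d') = m * (m * (b - b'))" "n * (d' - d) = m * (m * (b' - b))"
    proof -
      have "n * (d - d') = m * (p * d - p * d')" "n * (d' - d) = m * (p * d' - p * d)"
        by (simp_all add: m algebra_simps)
      then show "n * (d - d') = m * (m * (b - b'))" "n * (d' - d) = m * (m * (b' - b))"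
        unfolding d by (simp_all add: algebra_simps)
    qed
    show ?thesis
      unfolding \<gamma>_def \<gamma>'_def e d
      by (simp add: vec_eq_iff mat22_mult_nth forall_2 mat_def) (simp add: algebra_simps)
  qed
  then have "invertible \<gamma>" unfolding invertible_def by blast
  then have "\<gamma> \<in> Gamma0 n" by (simp add: Gamma0_def GL2_A_def \<gamma>_def)
  moreover have "M' = \<gamma> ** M"
  proof -
    have "(p * d - m * b') * p + (b' - b) * n = p * (p * d - m * b)"
      "(p * d - m * b') * b + (b' - b) * (p * d) = b' * (p * d - m * b)"
      "n * (d - d') * p + (p * d' - m * b) * n = n * (p * d - m * b)"
      "n * (d - d') * b + (p * d' - m * b) * (p * d) = p * d' * (p * d - m * b)"
      by (simp_all add: m algebra_simps)
    then show ?thesis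
      unfolding M_eq M'_eq \<gamma>_def by (simp add: vec_eq_iff mat22_mult_nth forall_2 bd)
  qed
  ultimately show ?thesis by blast
qed

lemma (in completed_algebraic_closure) atkin_lehner_eq:
  assumes P: "P \<noteq> 0" "P ^ \<alpha> dvd n"
    and M: "atkin_lehner_matrix n P \<alpha> M"
    and f: "f \<in> cusp_forms \<iota> \<omega> k l n" and z: "z \<in> Omega \<iota>"
  shows "atkin_lehner \<iota> k l n P \<alpha> f z = slash_A \<iota> k l f M z"
proof -
  define M' where "M' = (SOME M. atkin_lehner_matrix n P \<alpha> M)"
  have M': "atkin_lehner_matrix n P \<alpha> M'" unfolding M'_def using M by (rule someI)
  obtain \<gamma> where \<gamma>: "\<gamma> \<in> Gamma0 n" "M' = \<gamma> ** M"
    using atkin_lehner_matrix_unique[OF P M M'] by blast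
  have P2: "P ^ \<alpha> * (P ^ \<alpha> * d) = P ^ (2 * \<alpha>) * d" for d
    by (simp add: mult_2 power_add mult.assoc)
  have "det M' = P ^ \<alpha>"
    using M' by (auto simp: atkin_lehner_matrix_def det_2 mult.commute[of b n for b] P2)
  have "Kinf_of_poly (P ^ \<alpha>) \<noteq> 0"
    using P by simp
  then have "det (map_matrix Kinf_of_poly M') \<noteq> 0"
    using \<open>det M' = P ^ \<alpha>\<close> by (simp add: det_2 flip: Kinf_of_poly_simps Kinf_of_poly_diff)
  then have det: "det (map_matrix Kinf_of_poly \<gamma>) \<noteq> 0" "det (map_matrix Kinf_of_poly M) \<noteq> 0"
    unfolding \<gamma>(2) map_matrix_Kinf_mult det_mul by auto
  have "slash_A \<iota> k l f M' z = slash \<iota> k l (slash_A \<iota> k l f \<gamma>) (map_matrix Kinf_of_poly M) z"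
    unfolding \<gamma>(2) map_matrix_Kinf_mult by (rule slash_mult[OF z det])
  also have "\<dots> = slash_A \<iota> k l f M z"
    using f \<gamma>(1) frac_lin_in_Omega[OF z det(2)]
    by (simp add: slash_def[of _ _ _ _ "map_matrix Kinf_of_poly M"] cusp_forms_def)
  finally show ?thesis by (simp add: atkin_lehner_def M'_def)
qed

end

theory Submission
  imports Defs
begin

text \<open>
  Write \<open>\<beta>\<^sub>Q\<close> for the matrix with rows \<open>(1, Q)\<close> and \<open>(0, P\<^sub>1)\<close>, and \<open>M\<close> for an Atkin--Lehner matrix
  with rows \<open>(p, b)\<close> and \<open>(n, p d)\<close>, where \<open>p = P\<^sup>\<alpha>\<close>. The slash action turns the two sides into the
  sums of \<open>f | M \<beta>\<^sub>Q\<close> and of \<open>f | \<beta>\<^sub>Q M\<close> over the residues \<open>Q\<close> modulo \<open>P\<^sub>1\<close>, with the same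
  constant in front. As \<open>f\<close> is invariant under \<open>\<Gamma>\<^sub>0(n)\<close>, it is enough to match the cosets:
  \<open>\<beta>\<^sub>Q M\<close> lies in \<open>\<Gamma>\<^sub>0(n) M \<beta>\<^sub>R\<close> as soon as
  \<open>p R \<equiv> b + Q\<close> modulo \<open>P\<^sub>1\<close> (lemma \<open>atkin_lehner_coset_commute\<close>).

  As \<open>P\<^sub>1\<close> is a prime divisor of \<open>n\<close> other than \<open>P\<close>, it divides \<open>m = n / p\<close>, and the equation \<open>p d - m b = 1\<close>
  says that \<open>d\<close> inverts \<open>p\<close> modulo \<open>P\<^sub>1\<close>. The congruence therefore matches the residues \<open>Q\<close> and \<open>R\<close>
  bijectively, and the two sums agree term by term.
\<close>

lemma det_map_matrix_Kinf:
  "det (map_matrix Kinf_of_poly \<gamma>) = Kinf_of_poly (det \<gamma>)" for \<gamma> :: "'a::field poly^2^2"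
  by (simp add: det_2)

lemma invertible_2x2_if_det_1:
  fixes \<gamma> :: "'r::comm_ring_1^2^2"
  assumes "det \<gamma> = 1"
  shows "invertible \<gamma>"
proof -
  define \<delta> where "\<delta> = mat22 (\<gamma>$2$2) (- \<gamma>$1$2) (- \<gamma>$2$1) (\<gamma>$1$1)"
  have "\<gamma>$1$1 * \<gamma>$2$2 - \<gamma>$1$2 * \<gamma>$2$1 = 1"
    using assms by (simp add: det_2)
  then have "\<gamma> ** \<delta> = mat 1" "\<delta> ** \<gamma> = mat 1"
    by (simp_all add: \<delta>_def vec_eq_iff mat22_mult_nth forall_2 mat_def algebra_simps)
  then show ?thesis unfolding invertible_def by blast
qed

text \<open>
  The matrix \<open>\<gamma>\<close> is forced to be \<open>\<beta>\<^sub>Q M (M \<beta>\<^sub>R)\<^sup>-\<^sup>1\<close>, whose entries have the denominator \<open>p P\<^sub>1\<close>.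
  The factor \<open>p\<close> always cancels. In the second row \<open>P\<^sub>1\<close> cancels against the second row of
  \<open>\<beta>\<^sub>Q\<close>, in the upper left entry it cancels because it divides \<open>n / p = P\<^sub>1 s\<close>, and in the upper
  right entry because of the congruence \<open>p R = b + Q + P\<^sub>1 r\<close>.
\<close>

lemma atkin_lehner_coset_commute:
  fixes p b d s P\<^sub>1 Q R r :: "'r::idom"
  defines "n \<equiv> p * (P\<^sub>1 * s)"
  assumes bd: "p * d = 1 + P\<^sub>1 * s * b" and QR: "p * R = b + Q + P\<^sub>1 * r"
  shows "\<exists>\<gamma>. invertible \<gamma> \<and> n dvd \<gamma>$2$1 \<and>
    mat22 1 Q 0 P\<^sub>1 ** mat22 p b n (p * d) = \<gamma> ** (mat22 p b n (p * d) ** mat22 1 R 0 P\<^sub>1)"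
proof -
  define \<gamma> where "\<gamma> = mat22
    ((1 + Q * P\<^sub>1 * s) * (p * s * R + p * d) - s * (b + Q * (p * d)))
    (Q * s * b - r - b - Q * s * (p * R + b * P\<^sub>1))
    (n * (P\<^sub>1 * s * R + d * P\<^sub>1 - d))
    (p * d - P\<^sub>1 * s * (p * R + b * P\<^sub>1))"
  have "det \<gamma> = 1"
    unfolding det_2 \<gamma>_def mat22_nth n_def using bd QR by algebra
  then have "invertible \<gamma>" by (rule invertible_2x2_if_det_1)
  moreover have "n dvd \<gamma>$2$1" by (simp add: \<gamma>_def)
  moreover have
    "mat22 1 Q 0 P\<^sub>1 ** mat22 p b n (p * d) = \<gamma> ** (mat22 p b n (p * d) ** mat22 1 R 0 P\<^sub>1)"
    unfolding vec_eq_iff forall_2 mat22_mult_nth \<gamma>_def mat22_nth n_def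
    using bd QR by (intro conjI; algebra)
  ultimately show ?thesis by blast
qed

context completed_algebraic_closure
begin

lemma slash_A_mult:
  assumes "z \<in> Omega \<iota>" "det \<gamma> \<noteq> 0" "det \<delta> \<noteq> 0"
  shows "slash_A \<iota> k l f (\<gamma> ** \<delta>) z = slash_A \<iota> k l (slash_A \<iota> k l f \<gamma>) \<delta> z"
  unfolding map_matrix_Kinf_mult
  using assms by (intro slash_mult) (simp_all add: det_map_matrix_Kinf)

lemma slash_A_Gamma0_mult:
  assumes f: "f \<in> cusp_forms \<iota> \<omega> k l n" and \<gamma>: "\<gamma> \<in> Gamma0 n"
    and z: "z \<in> Omega \<iota>" and \<delta>: "det \<delta> \<noteq> 0"
  shows "slash_A \<iota> k l f (\<gamma> ** \<delta>) z = slash_A \<iota> k l f \<delta> z"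
proof -
  obtain \<gamma>' where "\<gamma> ** \<gamma>' = mat 1"
    using \<gamma> by (auto simp: Gamma0_def GL2_A_def invertible_def)
  then have "det \<gamma> * det \<gamma>' = 1" by (metis det_mul det_I)
  then have "det \<gamma> \<noteq> 0" by auto
  then have "slash_A \<iota> k l f (\<gamma> ** \<delta>) z = slash_A \<iota> k l (slash_A \<iota> k l f \<gamma>) \<delta> z"
    using z \<delta> by (intro slash_A_mult)
  moreover have "frac_lin \<iota> (map_matrix Kinf_of_poly \<delta>) z \<in> Omega \<iota>"
    using z \<delta> by (intro frac_lin_in_Omega) (simp_all add: det_map_matrix_Kinf)
  ultimately show ?thesis
    using f \<gamma> by (simp add: slash_def[of _ _ _ _ "map_matrix Kinf_of_poly \<delta>"] cusp_forms_def)
qed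

lemma U_operator_slash_A:
  assumes z: "z \<in> Omega \<iota>" and nz: "det M \<noteq> 0" "P\<^sub>1 \<noteq> 0"
  shows "U_operator \<iota> k l P\<^sub>1 (slash_A \<iota> k l f M) z = C_of_poly \<iota> P\<^sub>1 powi (int k - int l) *
    (\<Sum>Q | degree Q < degree P\<^sub>1. slash_A \<iota> k l f (M ** mat22 1 Q 0 P\<^sub>1) z)"
  unfolding U_operator_def using assms by (simp add: slash_A_mult det_2)

lemma slash_A_U_operator:
  assumes z: "z \<in> Omega \<iota>" and nz: "det M \<noteq> 0" "P\<^sub>1 \<noteq> 0"
  shows "slash_A \<iota> k l (U_operator \<iota> k l P\<^sub>1 f) M z = C_of_poly \<iota> P\<^sub>1 powi (int k - int l) *
    (\<Sum>Q | degree Q < degree P\<^sub>1. slash_A \<iota> k l f (mat22 1 Q 0 P\<^sub>1 ** M) z)"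
proof -
  have "slash_A \<iota> k l (U_operator \<iota> k l P\<^sub>1 f) M z = C_of_poly \<iota> P\<^sub>1 powi (int k - int l) *
    (\<Sum>Q | degree Q < degree P\<^sub>1. slash_A \<iota> k l (slash_A \<iota> k l f (mat22 1 Q 0 P\<^sub>1)) M z)"
    unfolding slash_def[of _ _ _ _ "map_matrix Kinf_of_poly M"] U_operator_def
    by (simp only: sum_distrib_left mult_ac)
  also have "(\<Sum>Q | degree Q < degree P\<^sub>1. slash_A \<iota> k l (slash_A \<iota> k l f (mat22 1 Q 0 P\<^sub>1)) M z) =
    (\<Sum>Q | degree Q < degree P\<^sub>1. slash_A \<iota> k l f (mat22 1 Q 0 P\<^sub>1 ** M) z)"
    using assms by (simp add: slash_A_mult det_2)
  finally show ?thesis .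
qed

text \<open>
  The bijection of residues sends \<open>R\<close> to \<open>p R - b\<close> and \<open>Q\<close> to \<open>d (b + Q)\<close>, both modulo \<open>P\<^sub>1\<close>.
\<close>

lemma U_operator_slash_A_commute:
  fixes p b d s P\<^sub>1 :: "'a poly"
  assumes f: "f \<in> cusp_forms \<iota> \<omega> k l (p * (P\<^sub>1 * s))" and z: "z \<in> Omega \<iota>"
    and bd: "p * d = 1 + P\<^sub>1 * s * b" and p: "p \<noteq> 0" and P\<^sub>1: "degree P\<^sub>1 > 0"
    and M: "M = mat22 p b (p * (P\<^sub>1 * s)) (p * d)"
  shows "U_operator \<iota> k l P\<^sub>1 (slash_A \<iota> k l f M) z =
    slash_A \<iota> k l (U_operator \<iota> k l P\<^sub>1 f) M z"
proof -
  have "det M = p * (p * d - P\<^sub>1 * s * b)"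
    by (simp add: M det_2 algebra_simps)
  then have det: "det M \<noteq> 0" using p by (simp add: bd)
  have P\<^sub>1_nz: "P\<^sub>1 \<noteq> 0" using P\<^sub>1 by auto
  have deg: "degree (x mod P\<^sub>1) < degree P\<^sub>1" for x
    using degree_mod_less[OF P\<^sub>1_nz, of x] P\<^sub>1 by auto
  have reduced: "x mod P\<^sub>1 = y" if "P\<^sub>1 dvd x - y" "degree y < degree P\<^sub>1" for x y
    using that by (metis mod_eq_dvd_iff mod_poly_less)
  have "(\<Sum>R | degree R < degree P\<^sub>1. slash_A \<iota> k l f (M ** mat22 1 R 0 P\<^sub>1) z) =
    (\<Sum>Q | degree Q < degree P\<^sub>1. slash_A \<iota> k l f (mat22 1 Q 0 P\<^sub>1 ** M) z)"
  proof (rule sum.reindex_bij_witness[of _ "\<lambda>Q. (d * (b + Q)) mod P\<^sub>1" "\<lambda>R. (p * R - b) mod P\<^sub>1"];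
      clarsimp simp: deg)
    fix R :: "'a poly" assume R: "degree R < degree P\<^sub>1"
    obtain r where r: "(p * R - b) mod P\<^sub>1 = p * R - b - P\<^sub>1 * r"
      by (metis minus_mult_div_eq_mod)
    have "d * (b + (p * R - b) mod P\<^sub>1) - R = P\<^sub>1 * (s * b * R - d * r)"
      unfolding r using bd by algebra
    then show "(d * (b + (p * R - b) mod P\<^sub>1)) mod P\<^sub>1 = R"
      using R by (intro reduced) simp_all
    have "p * R = b + (p * R - b) mod P\<^sub>1 + P\<^sub>1 * r"
      unfolding r by simp
    from atkin_lehner_coset_commute[OF bd this] obtain \<gamma>
      where \<gamma>: "\<gamma> \<in> Gamma0 (p * (P\<^sub>1 * s))"
        "mat22 1 ((p * R - b) mod P\<^sub>1) 0 P\<^sub>1 ** M = \<gamma> ** (M ** mat22 1 R 0 P\<^sub>1)"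
      unfolding M Gamma0_def GL2_A_def by blast
    have "det (M ** mat22 1 R 0 P\<^sub>1) \<noteq> 0"
      using det P\<^sub>1_nz unfolding det_mul by (simp add: det_2[of "mat22 _ _ _ _"])
    then show "slash_A \<iota> k l f (mat22 1 ((p * R - b) mod P\<^sub>1) 0 P\<^sub>1 ** M) z =
        slash_A \<iota> k l f (M ** mat22 1 R 0 P\<^sub>1) z"
      unfolding \<gamma>(2) by (intro slash_A_Gamma0_mult[OF f \<gamma>(1) z])
  next
    fix Q :: "'a poly" assume Q: "degree Q < degree P\<^sub>1"
    obtain r where r: "(d * (b + Q)) mod P\<^sub>1 = d * (b + Q) - P\<^sub>1 * r"
      by (metis minus_mult_div_eq_mod)
    have "p * ((d * (b + Q)) mod P\<^sub>1) - b - Q = P\<^sub>1 * (s * b * (b + Q) - p * r)"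
      unfolding r using bd by algebra
    then show "(p * ((d * (b + Q)) mod P\<^sub>1) - b) mod P\<^sub>1 = Q"
      using Q by (intro reduced) simp_all
  qed
  then show ?thesis
    by (simp only: U_operator_slash_A[OF z det P\<^sub>1_nz] slash_A_U_operator[OF z det P\<^sub>1_nz])
qed

end

theorem theorem5p4:
  fixes \<iota> :: "'a::{finite,field} fls \<Rightarrow> 'c::{field,complete_space}"
    and \<omega> :: 'c and n P :: "'a poly" and \<alpha> k l :: nat
  assumes "odd CARD('a)"
    and "completed_algebraic_closure \<iota>"
    and "carlitz_period \<iota> \<omega>"
    and "lead_coeff n = 1"
    and "lead_coeff P = 1" and "irreducible P"
    and "\<alpha> \<ge> 1" and "P ^ \<alpha> dvd n" and "coprime (P ^ \<alpha>) (n div P ^ \<alpha>)"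
    and "k \<ge> 1" and "l \<le> CARD('a) - 2" and "[k = 2 * l] (mod (CARD('a) - 1))"
  shows "\<forall>P\<^sub>1. lead_coeff P\<^sub>1 = 1 \<and> irreducible P\<^sub>1 \<and> P\<^sub>1 dvd n \<and> P\<^sub>1 \<noteq> P \<longrightarrow>
    (\<forall>f \<in> cusp_forms \<iota> \<omega> k l n. \<forall>z \<in> Omega \<iota>.
       U_operator \<iota> k l P\<^sub>1 (atkin_lehner \<iota> k l n P \<alpha> f) z =
       atkin_lehner \<iota> k l n P \<alpha> (U_operator \<iota> k l P\<^sub>1 f) z)"
proof (intro allI impI ballI)
  fix P\<^sub>1 f z
  assume P\<^sub>1: "lead_coeff P\<^sub>1 = 1 \<and> irreducible P\<^sub>1 \<and> P\<^sub>1 dvd n \<and> P\<^sub>1 \<noteq> P"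
    and f: "f \<in> cusp_forms \<iota> \<omega> k l n" and z: "z \<in> Omega \<iota>"
  interpret completed_algebraic_closure \<iota> by fact
  define p where "p = P ^ \<alpha>"
  have p: "p \<noteq> 0" using assms(6) by (auto simp: p_def)
  obtain m where m: "n = p * m" using assms(8) by (auto simp: p_def)
  have deg: "degree P\<^sub>1 > 0"
    using P\<^sub>1 by (metis irreducible_def is_unit_iff_degree not_gr_zero)
  have "\<not> P\<^sub>1 dvd P"
  proof
    assume "P\<^sub>1 dvd P"
    then obtain c where c: "P = P\<^sub>1 * c" by (rule dvdE)
    then have "is_unit c"
      using assms(6) P\<^sub>1 by (meson irreducibleD irreducible_not_unit)
    then obtain a where "c = [:a:]"
      by (metis is_unit_iff_degree degree_eq_zeroE not_is_unit_0)
    moreover have "lead_coeff c = 1"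
      using c P\<^sub>1 assms(5) by (simp add: lead_coeff_mult)
    ultimately show False using c P\<^sub>1 by simp
  qed
  moreover have prime: "prime_elem P\<^sub>1"
    using P\<^sub>1 by (simp add: field_poly_irreducible_imp_prime)
  ultimately have "\<not> P\<^sub>1 dvd p"
    unfolding p_def using prime_elem_dvd_power by blast
  then have "P\<^sub>1 dvd m"
    using P\<^sub>1 prime m by (metis prime_elem_dvd_multD)
  then obtain s where s: "m = P\<^sub>1 * s" by (rule dvdE)
  define M where "M = (SOME M. atkin_lehner_matrix n P \<alpha> M)"
  have "atkin_lehner_matrix n P \<alpha> M"
    unfolding M_def using atkin_lehner_matrix_exists[OF assms(8,9)] by (rule someI_ex)
  then obtain b d where "p * p * d - n * b = p" and M: "M = mat22 p b n (p * d)"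
    unfolding atkin_lehner_matrix_def by (auto simp: p_def mult_2 power_add)
  then have "p * (p * d) = p * (1 + P\<^sub>1 * s * b)"
    by (simp add: m s algebra_simps)
  then have bd: "p * d = 1 + P\<^sub>1 * s * b"
    using p by (simp only: mult_cancel_left) simp
  show "U_operator \<iota> k l P\<^sub>1 (atkin_lehner \<iota> k l n P \<alpha> f) z =
      atkin_lehner \<iota> k l n P \<alpha> (U_operator \<iota> k l P\<^sub>1 f) z"
    unfolding atkin_lehner_def M_def[symmetric]
    using U_operator_slash_A_commute[OF _ z bd p deg] f M unfolding m s by blast
qed

end
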